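(* Let $m\ge 1$ and let $n=2m$ or $n=2m-1$. For almost all choices (with respect to Lebesgue measure) of distinct points $t_0,t_1,\ldots,t_{\lfloor n/2\rfloor}$ in $(-1,1)$ if $n=2m$, respectively in $(-1,0)\cup(0,1)$ if $n=2m-1$, every polynomial $P_n\in\Pi_n^2$ is uniquely determined by the set of its Radon projections $$\mathcal R_{\phi_{j,m}}(P_n;t_k),\qquad 0\le j\le 2m,\quad 0\le k\le\lfloor n/2\rfloor,\qquad \phi_{j,m}=\frac{2j\pi}{2m+1};$$ that is, for almost every $(t_0,\ldots,t_{\lfloor n/2\rfloor})$, if $P,Q\in\Pi_n^2$ satisfy $\mathcal R_{\phi_{j,m}}(P;t_k)=\mathcal R_{\phi_{j,m}}(Q;t_k)$ for all $0\le j\le 2m$ and $0\le k\le\lfloor n/2\rfloor$, then $P=Q$.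
   Context: $\Pi_n^2$ is the space of real polynomials in two variables of total degree at most $n$. The Radon projection of a function $f$ on the closed unit disk in direction $\theta$ with parameter $t\in[-1,1]$ is $$\mathcal R_\theta(f;t)=\int_{-\sqrt{1-t^2}}^{\sqrt{1-t^2}} f(t\cos\theta-s\sin\theta,\;t\sin\theta+s\cos\theta)\,ds .$$ *)

theory Defs
  imports "HOL-Analysis.Analysis"
begin

text \<open>Since the reals are infinite, real polynomials in two variables are identified with the
  functions on the plane that they induce.\<close>

definition bipoly_space :: "nat \<Rightarrow> (real \<times> real \<Rightarrow> real) set" where
  "bipoly_space n =
     {P. \<exists>c :: nat \<Rightarrow> nat \<Rightarrow> real. \<forall>x y. P (x, y) = (\<Sum>i\<le>n. \<Sum>j\<le>n - i. c i j * x ^ i * y ^ j)}"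

definition radon :: "real \<Rightarrow> (real \<times> real \<Rightarrow> real) \<Rightarrow> real \<Rightarrow> real" where
  "radon \<theta> f t =
     integral {- sqrt (1 - t\<^sup>2) .. sqrt (1 - t\<^sup>2)}
       (\<lambda>s. f (t * cos \<theta> - s * sin \<theta>, t * sin \<theta> + s * cos \<theta>))"

definition radon_angle :: "nat \<Rightarrow> nat \<Rightarrow> real" where
  "radon_angle m j = 2 * real j * pi / (2 * real m + 1)"

end

theory Submission
  imports Defs "Jordan_Normal_Form.Determinant" "HOL-Number_Theory.Cong"
begin

text \<open>In the basis \<open>z ^ a * cnj z ^ b\<close>, the Radon projection at \<open>(\<theta>, t)\<close> is
  \<open>sqrt (1 - t\<^sup>2) * cis ((a - b) * \<theta>) * w\<^bsub>a,b\<^esub>(t)\<close>, where \<open>w\<^bsub>a,b\<^esub>\<close> is a polynomial of degree exactly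
  \<open>a + b\<close>. A discrete Fourier transform over the \<open>2 * m + 1\<close> angles separates the residue classes
  of \<open>a - b\<close> modulo \<open>2 * m + 1\<close>. Each class has at most as many members as there are
  points \<open>t k\<close>, and its polynomials have distinct degrees because the two frequencies \<open>a - b\<close> that
  share a residue have opposite parity. Polynomials with distinct degrees have a nonzero
  generalized Vandermonde determinant at almost every choice of points.\<close>


section \<open>Distinct degrees and generalized Vandermonde determinants\<close>

text \<open>Among the terms with nonzero coefficient, the one of largest degree has nothing to
  cancel its leading term.\<close>

lemma distinct_degrees_independent:
  fixes F :: "'i \<Rightarrow> complex poly"
  assumes fin: "finite I" and inj: "inj_on (\<lambda>i. degree (F i)) I"
    and nz: "\<And>i. i \<in> I \<Longrightarrow> F i \<noteq> 0"
    and eq: "(\<Sum>i\<in>I. Polynomial.smult (c i) (F i)) = 0" and i: "i \<in> I"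
  shows "c i = 0"
proof (rule ccontr)
  assume "c i \<noteq> 0"
  define S where "S = {i \<in> I. c i \<noteq> 0}"
  have S: "finite S" "S \<noteq> {}" using fin i \<open>c i \<noteq> 0\<close> by (auto simp: S_def)
  define d where "d = Max ((\<lambda>i. degree (F i)) ` S)"
  have "d \<in> (\<lambda>i. degree (F i)) ` S" unfolding d_def using S by (intro Max_in) auto
  then obtain k where k: "k \<in> S" "d = degree (F k)" by auto
  have le: "degree (F j) \<le> d" if "j \<in> S" for j unfolding d_def using S that by auto
  have "coeff (Polynomial.smult (c j) (F j)) d = 0" if "j \<in> I" "j \<noteq> k" for j
  proof (cases "j \<in> S")
    case True
    have "degree (F j) \<noteq> degree (F k)" using inj that k by (auto simp: S_def inj_on_def)
    then show ?thesis using le[OF True] k by (simp add: coeff_eq_0)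
  qed (use that in \<open>auto simp: S_def\<close>)
  then have "coeff (\<Sum>i\<in>I. Polynomial.smult (c i) (F i)) d
      = (\<Sum>i\<in>I. if i = k then coeff (Polynomial.smult (c k) (F k)) d else 0)"
    unfolding coeff_sum by (intro sum.cong) auto
  also have "\<dots> = coeff (Polynomial.smult (c k) (F k)) d"
    using k fin by (simp add: S_def)
  finally have "coeff (\<Sum>i\<in>I. Polynomial.smult (c i) (F i)) d = coeff (Polynomial.smult (c k) (F k)) d" .
  moreover have "coeff (Polynomial.smult (c k) (F k)) d \<noteq> 0" using k nz by (auto simp: S_def)
  ultimately show False using eq by simp
qed

lemma AE_poly_of_real_nonzero:
  fixes p :: "complex poly"
  assumes "p \<noteq> 0"
  shows "AE x in (lborel :: real measure). poly p (of_real x) \<noteq> 0"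
proof -
  have "finite {z. poly p z = 0}" using assms by (rule poly_roots_finite)
  then have "finite (of_real -` {z. poly p z = 0} :: real set)"
    by (rule finite_vimageI) (simp add: inj_on_def)
  then have "(of_real -` {z. poly p z = 0} :: real set) \<in> null_sets lborel"
    using finite_imp_null_set_lborel by blast
  from AE_not_in[OF this] show ?thesis by simp
qed

text \<open>The generalized Vandermonde matrix: \<open>F i = monom 1 i\<close> gives the classical
  one. Rows belong to points, so changing one point changes one row only.\<close>

definition eval_mat :: "nat \<Rightarrow> (nat \<Rightarrow> complex poly) \<Rightarrow> (nat \<Rightarrow> real) \<Rightarrow> complex mat" where
  "eval_mat N F t = mat N N (\<lambda>(k, i). poly (F i) (of_real (t k)))"

lemma eval_mat_carrier: "eval_mat N F t \<in> carrier_mat N N"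
  by (simp add: eval_mat_def)

text \<open>The Leibniz formula is a finite sum of products of continuous functions of single
  coordinates.\<close>

lemma measurable_det_eval_mat [measurable]:
  "(\<lambda>t. Determinant.det (eval_mat N F t)) \<in> borel_measurable (\<Pi>\<^sub>M k\<in>{..<N}. (lborel :: real measure))"
proof -
  have *: "Determinant.det (eval_mat N F t) = (\<Sum>p\<in>{p. p permutes {0..<N}}.
      signof p * (\<Prod>k=0..<N. poly (F (p k)) (of_real (t k))))" for t
    unfolding det_def'[OF eval_mat_carrier]
    by (intro sum.cong prod.cong arg_cong2[where f = "(*)"] refl)
      (auto simp: eval_mat_def permutes_in_image)
  have [measurable]: "(\<lambda>x::real. poly p (complex_of_real x)) \<in> borel_measurable borel" for p
    by (intro borel_measurable_continuous_onI continuous_intros)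
  show ?thesis unfolding *
    by (intro borel_measurable_sum borel_measurable_times borel_measurable_prod) measurable
qed

text \<open>In the Laplace expansion along row \<open>N\<close>, the cofactors do not involve the
  point \<open>t N\<close>. As a function of that point alone, the determinant is therefore a fixed
  combination of the \<open>F j\<close>.\<close>

lemma det_eval_mat_Suc:
  "Determinant.det (eval_mat (Suc N) F (t(N := x))) =
     poly (\<Sum>j<Suc N. Polynomial.smult (cofactor (eval_mat (Suc N) F t) N j) (F j)) (of_real x)"
proof -
  have "mat_delete (eval_mat (Suc N) F (t(N := x))) N j = mat_delete (eval_mat (Suc N) F t) N j" for j
    by (rule eq_matI) (auto simp: mat_delete_def eval_mat_def)
  then have c: "cofactor (eval_mat (Suc N) F (t(N := x))) N j = cofactor (eval_mat (Suc N) F t) N j" for j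
    by (simp add: cofactor_def)
  have e: "index_mat (eval_mat (Suc N) F (t(N := x))) (N, j) = poly (F j) (of_real x)"
    if "j < Suc N" for j
    using that by (simp add: eval_mat_def)
  show ?thesis
    by (subst laplace_expansion_row[OF eval_mat_carrier, of N])
      (simp_all add: c e poly_sum mult.commute del: sum.lessThan_Suc)
qed

text \<open>This identifies the coefficient of \<open>F N\<close> in the preceding expansion, which
  is how the induction hypothesis enters the next proof.\<close>

lemma cofactor_eval_mat: "cofactor (eval_mat (Suc N) F t) N N = Determinant.det (eval_mat N F t)"
proof -
  have "mat_delete (eval_mat (Suc N) F t) N N = eval_mat N F t"
    by (rule eq_matI) (auto simp: mat_delete_def eval_mat_def)
  then show ?thesis by (simp add: cofactor_def flip: mult_2)
qed

text \<open>Induction with Tonelli: for almost all first \<open>N\<close> points the coefficient of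
  \<open>F N\<close> is nonzero, so by independence the determinant is a nonzero polynomial in the
  last point, with finitely many roots.\<close>

lemma AE_det_eval_mat_nonzero:
  assumes "inj_on (\<lambda>i. degree (F i)) {..<N}" "\<And>i. i < N \<Longrightarrow> F i \<noteq> 0"
  shows "AE t in (\<Pi>\<^sub>M k\<in>{..<N}. (lborel :: real measure)). Determinant.det (eval_mat N F t) \<noteq> 0"
  using assms
proof (induction N)
  case 0
  then show ?case by (simp add: eval_mat_def det_dim_zero)
next
  case (Suc N)
  interpret product_sigma_finite "\<lambda>_::nat. lborel :: real measure" by standard
  let ?M = "\<lambda>N. \<Pi>\<^sub>M k\<in>{..<N}. (lborel :: real measure)"
  let ?D = "\<lambda>N t. Determinant.det (eval_mat N F t)"
  \<comment> \<open>The indicator of the zero set turns the claim into the vanishing of a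
    nonnegative integral, to which Tonelli applies.\<close>
  let ?z = "\<lambda>t. indicator {t. ?D (Suc N) t = 0} t :: ennreal"
  have meas [measurable]: "?z \<in> borel_measurable (?M (Suc N))" by measurable
  have "AE t in ?M N. ?D N t \<noteq> 0"
    using Suc by (intro Suc.IH) (auto intro: inj_on_subset)
  then have *: "AE t in ?M N. (\<integral>\<^sup>+ x. ?z (t(N := x)) \<partial>lborel) = 0"
  proof eventually_elim
    case (elim t)
    let ?p = "\<Sum>j<Suc N. Polynomial.smult (cofactor (eval_mat (Suc N) F t) N j) (F j)"
    have "?p \<noteq> 0"
    proof
      assume "?p = 0"
      from distinct_degrees_independent[OF _ Suc.prems(1) _ this, of N] Suc.prems(2) elim
      show False by (auto simp: cofactor_eval_mat)
    qed
    from AE_poly_of_real_nonzero[OF this]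
    have "AE x in lborel. ?z (t(N := x)) = 0"
      by eventually_elim (simp add: det_eval_mat_Suc del: sum.lessThan_Suc)
    then show ?case by (subst nn_integral_cong_AE[where v = "\<lambda>_. 0"]) auto
  qed
  have "integral\<^sup>N (?M (Suc N)) ?z = (\<integral>\<^sup>+ t. (\<integral>\<^sup>+ x. ?z (t(N := x)) \<partial>lborel) \<partial>?M N)"
    using product_nn_integral_insert[of "{..<N}" N ?z] meas by (simp add: lessThan_Suc)
  also have "\<dots> = 0"
    using * by (subst nn_integral_cong_AE[where v = "\<lambda>_. 0"]) auto
  finally have "AE t in ?M (Suc N). ?z t = 0" by (subst (asm) nn_integral_0_iff_AE) auto
  then show ?case by eventually_elim (auto simp: indicator_def split: if_splits)
qed

text \<open>A family with at most \<open>N\<close> members is padded to a square system. The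
  quantifier over \<open>c\<close> stands inside \<open>AE\<close>, so one null set serves all
  coefficients.\<close>

lemma AE_evaluation_injective:
  fixes F :: "'i \<Rightarrow> complex poly"
  assumes fin: "finite I" and card: "card I \<le> N" and inj: "inj_on (\<lambda>i. degree (F i)) I"
    and nz: "\<And>i. i \<in> I \<Longrightarrow> F i \<noteq> 0"
  shows "AE t in (\<Pi>\<^sub>M k\<in>{..<N}. (lborel :: real measure)).
    \<forall>c. (\<forall>k<N. (\<Sum>i\<in>I. c i * poly (F i) (of_real (t k))) = 0) \<longrightarrow> (\<forall>i\<in>I. c i = 0)"
proof -
  let ?r = "card I"
  obtain h where h: "bij_betw h {..<?r} I"
    using ex_bij_betw_nat_finite[OF fin] by (auto simp: atLeast0LessThan)
  have hI: "h i \<in> I" if "i < ?r" for i using h that by (auto simp: bij_betw_def)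
  \<comment> \<open>\<open>B\<close> exceeds every degree in the family, so the padding monomials of
    degree \<open>B + i\<close> create no coincidence of degrees; inserting \<open>0\<close> covers
    empty \<open>I\<close>.\<close>
  define B where "B = Suc (Max (insert 0 ((\<lambda>i. degree (F i)) ` I)))"
  have B: "degree (F i) < B" if "i \<in> I" for i
    unfolding B_def less_Suc_eq_le using fin that by (intro Max_ge) auto
  define G where "G i = (if i < ?r then F (h i) else monom 1 (B + i))" for i
  have degG: "degree (G i) = (if i < ?r then degree (F (h i)) else B + i)" for i
    by (simp add: G_def degree_monom_eq)
  have injG: "inj_on (\<lambda>i. degree (G i)) {..<N}"
  proof (rule inj_onI)
    fix i j assume eq: "degree (G i) = degree (G j)"
    have "i = j" if "i < ?r" "j < ?r"
    proof -
      have "h i = h j" using inj that eq hI by (auto simp: degG inj_on_def)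
      then show ?thesis using h that by (auto simp: bij_betw_def inj_on_def)
    qed
    then show "i = j" using eq B[OF hI, of i] B[OF hI, of j]
      by (cases "i < ?r"; cases "j < ?r") (auto simp: degG)
  qed
  have nzG: "G i \<noteq> 0" for i using nz hI by (auto simp: G_def)
  from AE_det_eval_mat_nonzero[OF injG nzG] show ?thesis
  proof eventually_elim
    case (elim t)
    show ?case
    proof (intro allI impI ballI)
      fix c i assume z: "\<forall>k<N. (\<Sum>i\<in>I. c i * poly (F i) (of_real (t k))) = 0" and i: "i \<in> I"
      \<comment> \<open>The padding columns receive coefficient zero, so the square system reduces
        to the given sums.\<close>
      define v where "v = Matrix.vec N (\<lambda>i. if i < ?r then c (h i) else 0)"
      have v: "v \<in> carrier_vec N" by (simp add: v_def)
      have "eval_mat N G t *\<^sub>v v = 0\<^sub>v N"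
      proof (rule eq_vecI)
        fix k assume "k < dim_vec (0\<^sub>v N :: complex Matrix.vec)"
        then have k: "k < N" by simp
        have "vec_index (eval_mat N G t *\<^sub>v v) k
            = (\<Sum>j<N. poly (G j) (of_real (t k)) * (if j < ?r then c (h j) else 0))"
          using k by (simp add: eval_mat_def v_def scalar_prod_def atLeast0LessThan)
        also have "\<dots> = (\<Sum>j<?r. c (h j) * poly (F (h j)) (of_real (t k)))"
          using card by (intro sum.mono_neutral_cong_right) (auto simp: G_def)
        also have "\<dots> = (\<Sum>i\<in>I. c i * poly (F i) (of_real (t k)))"
          by (rule sum.reindex_bij_betw[OF h])
        finally show "vec_index (eval_mat N G t *\<^sub>v v) k = vec_index (0\<^sub>v N) k"
          using z k by simp
      qed (simp add: eval_mat_def)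
      then have "v = 0\<^sub>v N"
        using elim det_0_iff_vec_prod_zero_field[OF eval_mat_carrier, of N G t] v by blast
      moreover obtain j where j: "j < ?r" "i = h j" using h i by (auto simp: bij_betw_def)
      ultimately have "vec_index v j = 0" using card by simp
      then show "c i = 0" using j card by (simp add: v_def)
    qed
  qed
qed


section \<open>Line integrals of \<open>z ^ a * cnj z ^ b\<close>\<close>

text \<open>The integral of \<open>s ^ j\<close> over \<open>{-1..1}\<close>.\<close>

definition sym_moment :: "nat \<Rightarrow> real" where
  "sym_moment j = (if even j then 2 / (real j + 1) else 0)"

text \<open>One factor \<open>u\<close> is split off and the rest uses only the square of
  \<open>u\<close>: for the half-chord \<open>u\<close> at distance \<open>t\<close>, the rest
  becomes a polynomial in \<open>t\<close>.\<close>

lemma has_integral_power_symmetric: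
  assumes "0 \<le> u"
  shows "((\<lambda>s::real. s ^ j) has_integral u * (sym_moment j * (u\<^sup>2) ^ (j div 2))) {-u..u}"
proof -
  have "((\<lambda>s::real. s ^ Suc j / (real j + 1)) has_real_derivative s ^ j) (at s within S)" for s S
    using DERIV_cdivide[OF DERIV_pow[of "Suc j" s S], of "real j + 1"] by (simp add: add.commute)
  then have "((\<lambda>s::real. s ^ j) has_integral u ^ Suc j / (real j + 1) - (- u) ^ Suc j / (real j + 1)) {-u..u}"
    using assms by (intro fundamental_theorem_of_calculus)
      (simp_all flip: has_real_derivative_iff_has_vector_derivative)
  moreover have "u ^ Suc j / (real j + 1) - (- u) ^ Suc j / (real j + 1)
      = u * (sym_moment j * (u\<^sup>2) ^ (j div 2))"
    by (cases "even j") (auto simp: sym_moment_def power_minus_odd elim!: evenE simp flip: power_mult)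
  ultimately show ?thesis by simp
qed

text \<open>The polynomial called \<open>w\<close> in the overview; \<open>[:1, 0, -1:]\<close> is
  the squared half-chord length as a polynomial in \<open>t\<close>.\<close>

definition radon_poly :: "nat \<Rightarrow> nat \<Rightarrow> complex poly" where
  "radon_poly a b = (\<Sum>p\<le>a. \<Sum>q\<le>b.
     Polynomial.smult (of_nat (a choose p) * of_nat (b choose q) * \<i> ^ p * (- \<i>) ^ q * of_real (sym_moment (p + q)))
       (monom 1 (a + b - (p + q)) * [:1, 0, -1:] ^ ((p + q) div 2)))"

lemma line_monomial_expansion:
  fixes t s :: complex
  shows "(t + \<i> * s) ^ a * (t - \<i> * s) ^ b = (\<Sum>p\<le>a. \<Sum>q\<le>b.
     of_nat (a choose p) * of_nat (b choose q) * \<i> ^ p * (- \<i>) ^ q * t ^ (a + b - (p + q)) * s ^ (p + q))"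
proof -
  have "(t + \<i> * s) ^ a * (t - \<i> * s) ^ b = (\<i> * s + t) ^ a * (- \<i> * s + t) ^ b"
    by (simp add: algebra_simps)
  also have "\<dots> = (\<Sum>p\<le>a. \<Sum>q\<le>b. (of_nat (a choose p) * (\<i> * s) ^ p * t ^ (a - p)) *
      (of_nat (b choose q) * (- \<i> * s) ^ q * t ^ (b - q)))"
    by (simp only: binomial_ring sum_product)
  also have "\<dots> = (\<Sum>p\<le>a. \<Sum>q\<le>b. of_nat (a choose p) * of_nat (b choose q) * \<i> ^ p * (- \<i>) ^ q *
      t ^ (a + b - (p + q)) * s ^ (p + q))"
  proof (intro sum.cong refl)
    fix p q assume "p \<in> {..a}" "q \<in> {..b}"
    \<comment> \<open>The bounds on \<open>p\<close> and \<open>q\<close> make the truncated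
      subtractions genuine.\<close>
    then have "a + b - (p + q) = (a - p) + (b - q)" by auto
    then show "(of_nat (a choose p) * (\<i> * s) ^ p * t ^ (a - p)) *
      (of_nat (b choose q) * (- \<i> * s) ^ q * t ^ (b - q)) = of_nat (a choose p) * of_nat (b choose q) *
      \<i> ^ p * (- \<i>) ^ q * t ^ (a + b - (p + q)) * s ^ (p + q)"
      unfolding power_mult_distrib by (simp add: power_add)
  qed
  finally show ?thesis .
qed

text \<open>After rotating the direction to angle zero, the line consists of the points
  \<open>t + \<i> * s\<close>. The binomial expansion is integrated term by term.\<close>

lemma has_integral_line_monomial:
  assumes "\<bar>t\<bar> \<le> 1"
  shows "((\<lambda>s. (of_real t + \<i> * of_real s) ^ a * (of_real t - \<i> * of_real s) ^ b) has_integral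
      of_real (sqrt (1 - t\<^sup>2)) * poly (radon_poly a b) (of_real t)) {- sqrt (1 - t\<^sup>2)..sqrt (1 - t\<^sup>2)}"
proof -
  have t: "t\<^sup>2 \<le> 1" using assms by (simp add: abs_square_le_1)
  let ?u = "sqrt (1 - t\<^sup>2)"
  let ?k = "\<lambda>p q. of_nat (a choose p) * of_nat (b choose q) * \<i> ^ p * (- \<i>) ^ q * of_real t ^ (a + b - (p + q)) :: complex"
  have "((\<lambda>s. of_real s ^ j) has_integral complex_of_real (?u * (sym_moment j * (1 - t\<^sup>2) ^ (j div 2)))) {- ?u..?u}" for j
    using has_integral_of_real[OF has_integral_power_symmetric[of ?u j], where 'b = complex] t by simp
  then have "((\<lambda>s. \<Sum>p\<le>a. \<Sum>q\<le>b. ?k p q * of_real s ^ (p + q)) has_integral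
     (\<Sum>p\<le>a. \<Sum>q\<le>b. ?k p q * complex_of_real (?u * (sym_moment (p + q) * (1 - t\<^sup>2) ^ ((p + q) div 2))))) {- ?u..?u}"
    by (intro has_integral_sum has_integral_mult_right) auto
  also have "(\<Sum>p\<le>a. \<Sum>q\<le>b. ?k p q * complex_of_real (?u * (sym_moment (p + q) * (1 - t\<^sup>2) ^ ((p + q) div 2))))
     = of_real ?u * poly (radon_poly a b) (of_real t)"
    unfolding radon_poly_def poly_sum sum_distrib_left
    by (intro sum.cong refl) (simp add: poly_monom power2_eq_square)
  finally show ?thesis unfolding line_monomial_expansion .
qed

text \<open>The formal substitution \<open>s = \<i> * t * v\<close> in the line integral shows that the leading coefficient
  is the integral of \<open>(1 - v) ^ a * (1 + v) ^ b\<close> over \<open>{-1..1}\<close>, which is positive.\<close>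

lemma degree_radon_poly: "degree (radon_poly a b) = a + b" and radon_poly_nonzero: "radon_poly a b \<noteq> 0"
proof -
  let ?N = "a + b" and ?R = "[:1, 0, -1:] :: complex poly"
  let ?I = "\<lambda>v::real. (1 - v) ^ a * (1 + v) ^ b"
  have degR: "degree (?R ^ h) = 2 * h" for h by (subst degree_power_eq) auto
  have lcR: "coeff (?R ^ h) (2 * h) = (-1) ^ h" for h
    using lead_coeff_power[of ?R h] unfolding degR by simp
  have le: "degree (radon_poly a b) \<le> ?N"
    unfolding radon_poly_def
  proof (intro degree_sum_le finite_atMost)
    fix p q assume "p \<in> {..a}" "q \<in> {..b}"
    have "degree (monom (1::complex) (?N - (p + q)) * ?R ^ ((p + q) div 2)) \<le> (?N - (p + q)) + 2 * ((p + q) div 2)"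
      by (rule order_trans[OF degree_mult_le]) (simp add: degR degree_monom_eq)
    also have "\<dots> \<le> ?N" using \<open>p \<in> _\<close> \<open>q \<in> _\<close> by auto
    finally show "degree (Polynomial.smult (of_nat (a choose p) * of_nat (b choose q) * \<i> ^ p * (- \<i>) ^ q * of_real (sym_moment (p + q)))
       (monom 1 (a + b - (p + q)) * [:1, 0, -1:] ^ ((p + q) div 2))) \<le> ?N"
      by (intro order_trans[OF degree_smult_le])
  qed
  have moment: "((\<lambda>s::real. s ^ j) has_integral sym_moment j) {-1..1}" for j
    using has_integral_power_symmetric[of 1 j] by simp
  have "?I v = (\<Sum>p\<le>a. \<Sum>q\<le>b. (-1) ^ p * real (a choose p) * real (b choose q) * v ^ (p + q))" for v
  proof -
    have "?I v = (- v + 1) ^ a * (v + 1) ^ b" by (simp add: algebra_simps)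
    also have "\<dots> = (\<Sum>p\<le>a. \<Sum>q\<le>b. (real (a choose p) * (- v) ^ p * 1 ^ (a - p)) * (real (b choose q) * v ^ q * 1 ^ (b - q)))"
      by (simp only: binomial_ring sum_product)
    also have "\<dots> = (\<Sum>p\<le>a. \<Sum>q\<le>b. (-1) ^ p * real (a choose p) * real (b choose q) * v ^ (p + q))"
      by (intro sum.cong refl) (simp add: power_minus[of v] power_add)
    finally show ?thesis .
  qed
  then have "(?I has_integral (\<Sum>p\<le>a. \<Sum>q\<le>b. (-1) ^ p * real (a choose p) * real (b choose q) * sym_moment (p + q))) {-1..1}"
    by (simp only:) (intro has_integral_sum has_integral_mult_right moment finite_atMost)
  then have int: "integral {-1..1} ?I = (\<Sum>p\<le>a. \<Sum>q\<le>b. (-1) ^ p * real (a choose p) * real (b choose q) * sym_moment (p + q))"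
    by (rule integral_unique)
  \<comment> \<open>A continuous nonnegative integrand with zero integral vanishes identically, but
    this one equals 1 at \<open>0\<close>.\<close>
  have "integral {-1..1} ?I \<noteq> 0"
  proof
    assume "integral {-1..1} ?I = 0"
    moreover have "continuous_on {-1..1} ?I" by (intro continuous_intros)
    ultimately have "\<forall>v\<in>{-1..1}. ?I v = 0" by (subst (asm) integral_eq_0_iff) auto
    from this[rule_format, of 0] show False by simp
  qed
  moreover have "coeff (radon_poly a b) ?N = of_real (integral {-1..1} ?I)"
    unfolding int radon_poly_def coeff_sum of_real_sum
  proof (intro sum.cong refl)
    fix p q assume "p \<in> {..a}" "q \<in> {..b}"
    then have N: "\<not> ?N < ?N - (p + q)" "?N - (?N - (p + q)) = p + q" by auto
    \<comment> \<open>Writing the last sign as \<open>\<i> ^ (p + q)\<close> pairs the factors: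
      \<open>\<i> * \<i> = -1\<close> occurs \<open>p\<close> times and
      \<open>- \<i> * \<i> = 1\<close> occurs \<open>q\<close> times. For odd \<open>p + q\<close>
      the moment is zero.\<close>
    have "\<i> ^ p * (- \<i>) ^ q * (-1) ^ ((p + q) div 2) = (- 1) ^ p" if "even (p + q)"
    proof -
      have "\<i> ^ (p + q) = (-1) ^ ((p + q) div 2)"
        using that by (metis dvd_mult_div_cancel i_squared power2_eq_square power_mult)
      then have "\<i> ^ p * (- \<i>) ^ q * (-1) ^ ((p + q) div 2) = (\<i> * \<i>) ^ p * (- \<i> * \<i>) ^ q"
        unfolding power_mult_distrib power_add by simp
      then show ?thesis by simp
    qed
    moreover have "coeff (?R ^ ((p + q) div 2)) (p + q) = (-1) ^ ((p + q) div 2)" if "even (p + q)"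
      using lcR[of "(p + q) div 2"] that by simp
    ultimately show "coeff (Polynomial.smult (of_nat (a choose p) * of_nat (b choose q) * \<i> ^ p * (- \<i>) ^ q * of_real (sym_moment (p + q)))
       (monom 1 (a + b - (p + q)) * [:1, 0, -1:] ^ ((p + q) div 2))) ?N
       = of_real ((-1) ^ p * real (a choose p) * real (b choose q) * sym_moment (p + q))"
      using N by (cases "even (p + q)") (simp_all add: coeff_monom_mult sym_moment_def mult_ac)
  qed
  ultimately have "coeff (radon_poly a b) ?N \<noteq> 0" by simp
  then show "radon_poly a b \<noteq> 0" "degree (radon_poly a b) = ?N"
    using le le_degree[of "radon_poly a b" ?N] by auto
qed


section \<open>Real polynomials in the coordinates \<open>z\<close> and \<open>cnj z\<close>\<close>

definition deg_pairs :: "nat \<Rightarrow> (nat \<times> nat) set" where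
  "deg_pairs n = {(a, b). a + b \<le> n}"

lemma finite_deg_pairs [simp]: "finite (deg_pairs n)"
  by (rule finite_subset[of _ "{..n} \<times> {..n}"]) (auto simp: deg_pairs_def)

text \<open>Rotation multiplies each \<open>z ^ a * cnj z ^ b\<close> by a scalar, so this basis
  diagonalizes the dependence on the angle.\<close>

definition conj_poly :: "nat \<Rightarrow> (complex \<Rightarrow> complex) set" where
  "conj_poly n = {f. \<exists>c. \<forall>z. f z = (\<Sum>(a, b)\<in>deg_pairs n. c (a, b) * (z ^ a * cnj z ^ b))}"

lemma conj_poly_add: "f \<in> conj_poly n \<Longrightarrow> g \<in> conj_poly n \<Longrightarrow> (\<lambda>z. f z + g z) \<in> conj_poly n"
proof -
  assume "f \<in> conj_poly n" "g \<in> conj_poly n"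
  then obtain c d where "f z = (\<Sum>(a, b)\<in>deg_pairs n. c (a, b) * (z ^ a * cnj z ^ b))"
      "g z = (\<Sum>(a, b)\<in>deg_pairs n. d (a, b) * (z ^ a * cnj z ^ b))" for z
    by (auto simp: conj_poly_def)
  then show ?thesis unfolding conj_poly_def
    by (auto intro!: exI[of _ "\<lambda>p. c p + d p"] simp: case_prod_beta algebra_simps sum.distrib)
qed

lemma conj_poly_scale: "f \<in> conj_poly n \<Longrightarrow> (\<lambda>z. k * f z) \<in> conj_poly n"
proof -
  assume "f \<in> conj_poly n"
  then obtain c where "f z = (\<Sum>(a, b)\<in>deg_pairs n. c (a, b) * (z ^ a * cnj z ^ b))" for z
    by (auto simp: conj_poly_def)
  then show ?thesis unfolding conj_poly_def
    by (auto intro!: exI[of _ "\<lambda>p. k * c p"] simp: case_prod_beta mult.assoc sum_distrib_left)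
qed

lemma conj_poly_sum: "(\<And>i. i \<in> A \<Longrightarrow> f i \<in> conj_poly n) \<Longrightarrow> (\<lambda>z. \<Sum>i\<in>A. f i z) \<in> conj_poly n"
proof (induction A rule: infinite_finite_induct)
  case (insert i A)
  then show ?case using conj_poly_add[of "f i" n "\<lambda>z. \<Sum>i\<in>A. f i z"] by simp
qed (auto simp: conj_poly_def intro!: exI[of _ "\<lambda>_. 0"])

lemma conj_poly_monomial: "a + b \<le> n \<Longrightarrow> (\<lambda>z. z ^ a * cnj z ^ b) \<in> conj_poly n"
proof -
  assume "a + b \<le> n"
  then have "(a, b) \<in> deg_pairs n" by (simp add: deg_pairs_def)
  then have "z ^ a * cnj z ^ b = (\<Sum>p\<in>deg_pairs n. (if p = (a, b) then 1 else 0) * (z ^ fst p * cnj z ^ snd p))" for z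
    by (subst sum.remove[of _ "(a, b)"]) (simp_all add: sum.neutral)
  then show ?thesis unfolding conj_poly_def case_prod_beta by auto
qed

text \<open>Substitute \<open>(z + cnj z) / 2\<close> and \<open>(z - cnj z) / (2 * \<i>)\<close>
  for the real and imaginary parts and expand; every term has total degree
  \<open>i + j\<close>.\<close>

lemma conj_poly_Re_Im:
  assumes "i + j \<le> n"
  shows "(\<lambda>z. of_real (Re z ^ i * Im z ^ j)) \<in> conj_poly n"
proof -
  have "complex_of_real (Re z ^ i * Im z ^ j) = (\<Sum>p\<le>i. \<Sum>q\<le>j.
      (of_nat (i choose p) * of_nat (j choose q) * (1 / 2) ^ i * (1 / (2 * \<i>)) ^ j * (-1) ^ (j - q)) *
      (z ^ (p + q) * cnj z ^ ((i - p) + (j - q))))" for z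
  proof -
    have re: "complex_of_real (Re z) = (1 / 2) * (z + cnj z)"
      and im: "complex_of_real (Im z) = (1 / (2 * \<i>)) * (z + - cnj z)"
      by (simp_all add: complex_eq_iff)
    have "complex_of_real (Re z ^ i * Im z ^ j) =
        ((1 / 2) ^ i * (1 / (2 * \<i>)) ^ j) * ((z + cnj z) ^ i * (z + - cnj z) ^ j)"
      by (simp only: of_real_mult of_real_power re im power_mult_distrib mult_ac)
    also have "\<dots> = (\<Sum>p\<le>i. \<Sum>q\<le>j. ((1 / 2) ^ i * (1 / (2 * \<i>)) ^ j) *
        ((of_nat (i choose p) * z ^ p * cnj z ^ (i - p)) * (of_nat (j choose q) * z ^ q * (- cnj z) ^ (j - q))))"
      unfolding binomial_ring sum_product unfolding sum_distrib_left ..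
    also have "\<dots> = (\<Sum>p\<le>i. \<Sum>q\<le>j.
      (of_nat (i choose p) * of_nat (j choose q) * (1 / 2) ^ i * (1 / (2 * \<i>)) ^ j * (-1) ^ (j - q)) *
      (z ^ (p + q) * cnj z ^ ((i - p) + (j - q))))"
      unfolding power_minus[of "cnj z"] power_add by (simp only: mult_ac)
    finally show ?thesis .
  qed
  then show ?thesis using assms
    by (simp only:) (intro conj_poly_sum conj_poly_scale conj_poly_monomial, auto)
qed

lemma bipoly_space_conj_poly:
  assumes "P \<in> bipoly_space n"
  shows "(\<lambda>z. of_real (P (Re z, Im z))) \<in> conj_poly n"
proof -
  obtain c where "P (x, y) = (\<Sum>i\<le>n. \<Sum>j\<le>n - i. c i j * x ^ i * y ^ j)" for x y
    using assms by (auto simp: bipoly_space_def)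
  then have "complex_of_real (P (Re z, Im z)) = (\<Sum>i\<le>n. \<Sum>j\<le>n - i. of_real (c i j) * of_real (Re z ^ i * Im z ^ j))" for z
    by (simp add: mult.assoc)
  then show ?thesis
    by (simp only:) (intro conj_poly_sum conj_poly_scale conj_poly_Re_Im, auto)
qed

section \<open>Discrete Fourier transform and residue classes of frequencies\<close>

text \<open>Orthogonality of the \<open>M\<close>-th roots of unity: weighting equation
  \<open>j\<close> by the conjugate character and summing over \<open>j\<close> keeps only the
  residue \<open>r\<close>.\<close>

lemma discrete_fourier_separation:
  fixes g :: "'i \<Rightarrow> nat" and x :: "'i \<Rightarrow> complex"
  assumes "finite I" "0 < M" "r < M"
    and eq: "\<And>j. j < M \<Longrightarrow> (\<Sum>i\<in>I. x i * cis (2 * pi * real j / real M) ^ g i) = 0"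
  shows "(\<Sum>i\<in>{i\<in>I. g i mod M = r}. x i) = 0"
proof -
  let ?w = "\<lambda>k. cis (2 * pi * real k / real M)"
  have w_eq_1: "?w k = 1 \<longleftrightarrow> M dvd k" for k
    using complex_root_unity_eq_1[of M k] \<open>0 < M\<close>
    by (simp add: cis_conv_exp mult_ac)
  have w_pow: "?w j ^ k = ?w k ^ j" for j k
    by (simp add: Complex.DeMoivre field_simps)
  have geom: "(\<Sum>j<M. ?w j ^ k) = (if M dvd k then of_nat M else 0)" for k
  proof -
    have "?w k ^ M = 1"
      using \<open>0 < M\<close> w_eq_1[of "k * M"] by (simp add: Complex.DeMoivre field_simps)
    then show ?thesis unfolding w_pow[of _ k] by (simp add: sum_gp_strict w_eq_1)
  qed
  have dvd: "M dvd (g i + (M - r)) \<longleftrightarrow> g i mod M = r" for i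
  proof -
    have "M dvd (g i + (M - r)) \<longleftrightarrow> (g i + (M - r)) mod M = (r + (M - r)) mod M"
      using \<open>r < M\<close> by (simp add: dvd_eq_mod_eq_0)
    also have "\<dots> \<longleftrightarrow> g i mod M = r mod M"
      by (metis cong_def cong_add_rcancel_nat)
    finally show ?thesis using \<open>r < M\<close> by simp
  qed
  \<comment> \<open>\<open>M - r\<close> stands for \<open>- r\<close> modulo \<open>M\<close>,
    which keeps the exponents natural numbers.\<close>
  have "0 = (\<Sum>j<M. ?w j ^ (M - r) * (\<Sum>i\<in>I. x i * ?w j ^ g i))"
    using eq by simp
  also have "\<dots> = (\<Sum>i\<in>I. x i * (\<Sum>j<M. ?w j ^ (g i + (M - r))))"
    unfolding sum_distrib_left by (subst sum.swap) (simp add: power_add mult_ac)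
  also have "\<dots> = (\<Sum>i\<in>I. if g i mod M = r then of_nat M * x i else 0)"
    unfolding geom dvd by (intro sum.cong) auto
  also have "\<dots> = of_nat M * (\<Sum>i\<in>{i\<in>I. g i mod M = r}. x i)"
    unfolding sum_distrib_left using \<open>finite I\<close> by (simp add: sum.inter_filter)
  finally show ?thesis using \<open>0 < M\<close> by simp
qed

text \<open>Modulo \<open>2 * m + 1\<close>, the number \<open>a + 2 * m * b\<close> is the angular frequency \<open>a - b\<close> of
  \<open>z ^ a * cnj z ^ b\<close>.\<close>

definition freq_class :: "nat \<Rightarrow> nat \<Rightarrow> nat \<Rightarrow> (nat \<times> nat) set" where
  "freq_class m n r = {(a, b)\<in>deg_pairs n. (a + 2 * m * b) mod (2 * m + 1) = r}"

text \<open>Frequencies lie between \<open>- 2 * m\<close> and \<open>2 * m\<close>, so a residue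
  \<open>r\<close> arises only from \<open>a - b = r\<close> or from
  \<open>a - b = r - (2 * m + 1)\<close>.\<close>

lemma freq_class_cases:
  assumes "(a, b) \<in> freq_class m n r" "n \<le> 2 * m"
  shows "b \<le> a \<and> a = b + r \<or> a < b \<and> a + (2 * m + 1) = b + r"
proof -
  have ab: "a + b \<le> n" and r: "(a + 2 * m * b) mod (2 * m + 1) = r"
    using assms by (auto simp: freq_class_def deg_pairs_def)
  show ?thesis
  proof (cases "b \<le> a")
    case True
    have "a + 2 * m * b = (a - b) + b * (2 * m + 1)" using True by (simp add: algebra_simps)
    then have "r = (a - b) mod (2 * m + 1)" using r by (metis mod_mult_self1)
    then show ?thesis using True ab assms(2) by simp
  next
    case False
    then obtain b' where b': "b = Suc b'" by (cases b) auto
    have "a + 2 * m * b = (a + (2 * m + 1) - b) + b' * (2 * m + 1)"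
      using False ab assms(2) by (simp add: b' algebra_simps)
    then have "r = (a + (2 * m + 1) - b) mod (2 * m + 1)" using r by (metis mod_mult_self1)
    then show ?thesis using False ab assms(2) by simp
  qed
qed

text \<open>The degree \<open>a + b\<close> has the parity of \<open>a - b\<close>, so pairs of
  equal degree share the same frequency; sum and difference then determine the pair.\<close>

lemma freq_class_degree_inj:
  assumes "n \<le> 2 * m"
  shows "inj_on (\<lambda>(a, b). a + b) (freq_class m n r)"
proof -
  have parity: False if "a = b + r" "a' + (2 * m + 1) = b' + r" "a + b = a' + b'" for a b a' b' :: nat
  proof -
    have "2 * (b + r) = 2 * (a' + m) + 1" using that by simp
    then show False by presburger
  qed
  show ?thesis
  proof (rule inj_onI, clarify)
    fix a b a' b' assume *: "(a, b) \<in> freq_class m n r" "(a', b') \<in> freq_class m n r" "a + b = a' + b'"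
    show "a = a' \<and> b = b'"
      using freq_class_cases[OF *(1) assms] freq_class_cases[OF *(2) assms]
    proof (elim disjE conjE)
      assume "a = b + r" "a' = b' + r"
      with *(3) show ?thesis by simp
    next
      assume "a + (2 * m + 1) = b + r" "a' + (2 * m + 1) = b' + r"
      with *(3) show ?thesis by linarith
    qed (use parity[of a b a' b'] parity[of a' b' a b] *(3) in auto)
  qed
qed

lemma card_freq_class:
  assumes "m \<ge> 1" "n = 2 * m \<or> n = 2 * m - 1"
  shows "card (freq_class m n r) \<le> Suc (n div 2)"
proof -
  \<comment> \<open>Pairs of nonnegative frequency are counted upwards from 0 by \<open>b\<close>,
    those of negative frequency downwards from \<open>n div 2\<close> by \<open>a\<close>.\<close>
  let ?g = "\<lambda>(a, b). if b \<le> a then b else n div 2 - a"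
  have n: "n \<le> 2 * m" using assms by auto
  \<comment> \<open>The two counts never meet: adding the degree bounds gives
    \<open>2 * (a' + b) + 2 * m + 1 \<le> 2 * n\<close>, which fails for
    \<open>a' + b = n div 2\<close> with either choice of \<open>n\<close>.\<close>
  have mixed: False
    if "(a, b) \<in> freq_class m n r" "(a', b') \<in> freq_class m n r" "b \<le> a" "a' < b'" "b = n div 2 - a'"
    for a b a' b'
  proof -
    have "a + b \<le> n" "a' + b' \<le> n" using that by (auto simp: freq_class_def deg_pairs_def)
    moreover have "a = b + r" using freq_class_cases[OF that(1) n] that(3) by auto
    moreover have "a' + (2 * m + 1) = b' + r" using freq_class_cases[OF that(2) n] that(4) by auto
    moreover have "n = 2 * m \<and> n div 2 = m \<or> n = 2 * m - 1 \<and> n div 2 = m - 1"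
      using assms by presburger
    ultimately show False using that(4,5) assms(1) by linarith
  qed
  have "inj_on ?g (freq_class m n r)"
  proof (rule inj_onI, clarify)
    fix a b a' b' assume *: "(a, b) \<in> freq_class m n r" "(a', b') \<in> freq_class m n r"
      "(if b \<le> a then b else n div 2 - a) = (if b' \<le> a' then b' else n div 2 - a')"
    have le: "a + b \<le> n" "a' + b' \<le> n" using * by (auto simp: freq_class_def deg_pairs_def)
    show "a = a' \<and> b = b'"
    proof (cases "b \<le> a")
      case True
      then have "b' \<le> a'" using mixed[OF *(1,2) True] *(3) by (cases "b' \<le> a'") auto
      then show ?thesis
        using True *(3) freq_class_cases[OF *(1) n] freq_class_cases[OF *(2) n] by auto
    next
      case False
      have lt: "a' < b'"
      proof (rule ccontr)
        assume "\<not> a' < b'"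
        then have "b' \<le> a'" by simp
        moreover from this have "b' = n div 2 - a" using False *(3) by simp
        ultimately show False using mixed[OF *(2,1)] False by simp
      qed
      then have "n div 2 - a = n div 2 - a'" using False *(3) by simp
      \<comment> \<open>From \<open>a < b\<close> and \<open>a + b \<le> n\<close> follows
        \<open>a \<le> n div 2\<close>, likewise for \<open>a'\<close>, so neither subtraction
        truncates.\<close>
      then have "a = a'" using le lt False by linarith
      then show ?thesis
        using False lt freq_class_cases[OF *(1) n] freq_class_cases[OF *(2) n] by auto
    qed
  qed
  moreover have "?g ` freq_class m n r \<subseteq> {..n div 2}"
    by (auto simp: freq_class_def deg_pairs_def)
  ultimately show ?thesis using card_inj_on_le[of ?g "freq_class m n r" "{..n div 2}"] by simp
qed


section \<open>Radon projections of polynomials and unique determination\<close>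

text \<open>The line of integration consists of the points
  \<open>cis \<theta> * (t + \<i> * s)\<close>, so the powers of \<open>cis \<theta>\<close> factor
  out of each monomial.\<close>

lemma radon_conj_poly:
  assumes P: "\<And>z. of_real (P (Re z, Im z)) = (\<Sum>(a, b)\<in>deg_pairs n. c (a, b) * (z ^ a * cnj z ^ b))"
    and t: "\<bar>t\<bar> \<le> 1"
  shows "complex_of_real (radon \<theta> P t) = of_real (sqrt (1 - t\<^sup>2)) *
    (\<Sum>(a, b)\<in>deg_pairs n. c (a, b) * (cis \<theta> ^ a * cnj (cis \<theta>) ^ b) * poly (radon_poly a b) (of_real t))"
    (is "_ = ?R")
proof -
  let ?f = "\<lambda>s. P (t * cos \<theta> - s * sin \<theta>, t * sin \<theta> + s * cos \<theta>)"
  let ?I = "{- sqrt (1 - t\<^sup>2)..sqrt (1 - t\<^sup>2)}"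
  have f: "complex_of_real (?f s) = (\<Sum>(a, b)\<in>deg_pairs n. c (a, b) * (cis \<theta> ^ a * cnj (cis \<theta>) ^ b) *
      ((of_real t + \<i> * of_real s) ^ a * (of_real t - \<i> * of_real s) ^ b))" for s
  proof -
    have "Re (cis \<theta> * (of_real t + \<i> * of_real s)) = t * cos \<theta> - s * sin \<theta>"
      "Im (cis \<theta> * (of_real t + \<i> * of_real s)) = t * sin \<theta> + s * cos \<theta>"
      by (simp_all add: algebra_simps)
    with P[of "cis \<theta> * (of_real t + \<i> * of_real s)"] show ?thesis
      by (simp add: power_mult_distrib mult_ac add.commute)
  qed
  have scaled: "((\<lambda>s. k * ((of_real t + \<i> * of_real s) ^ a * (of_real t - \<i> * of_real s) ^ b)) has_integral
      of_real (sqrt (1 - t\<^sup>2)) * (k * poly (radon_poly a b) (of_real t))) ?I" for k a b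
    using has_integral_mult_right[OF has_integral_line_monomial[OF t, of a b], of k]
    by (simp add: mult_ac)
  have *: "((\<lambda>s. complex_of_real (?f s)) has_integral ?R) ?I"
    unfolding f sum_distrib_left case_prod_beta
    by (intro has_integral_sum finite_deg_pairs scaled)
  \<comment> \<open>Real parts give integrability of the real integrand, so that the
    \<open>integral\<close> in \<open>radon\<close> is a genuine value and not a default.\<close>
  have "(?f has_integral Re ?R) ?I"
    using has_integral_linear[OF * bounded_linear_Re] by (simp add: o_def)
  then have "?f integrable_on ?I" by blast
  then have "(?f has_integral radon \<theta> P t) ?I"
    unfolding radon_def by (rule integrable_integral)
  then have "((\<lambda>s. complex_of_real (?f s)) has_integral of_real (radon \<theta> P t)) ?I"
    by (rule has_integral_of_real)
  then show ?thesis using * by (rule has_integral_unique)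
qed

text \<open>At these angles \<open>cis\<close> is a root of unity of order dividing
  \<open>2 * m + 1\<close>, so its conjugate is its power \<open>2 * m\<close>.\<close>

lemma cis_radon_angle_frequency:
  "cis (radon_angle m j) ^ a * cnj (cis (radon_angle m j)) ^ b
     = cis (2 * pi * real j / real (2 * m + 1)) ^ (a + 2 * m * b)"
proof -
  let ?w = "cis (radon_angle m j)"
  have ang: "radon_angle m j = 2 * pi * real j / real (2 * m + 1)"
    by (simp add: radon_angle_def mult_ac)
  have "real (2 * m + 1) * radon_angle m j = 2 * pi * real j"
    unfolding ang by simp
  then have "?w ^ (2 * m + 1) = 1"
    unfolding Complex.DeMoivre by (simp only:) (simp add: cis_multiple_2pi)
  then have "?w ^ (2 * m) = cnj ?w"
    by (simp add: cis_cnj cis_inverse[symmetric] field_simps)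
  then show ?thesis
    unfolding ang[symmetric] power_add power_mult[of _ "2 * m"] by simp
qed

theorem corollary2p8:
  fixes m n :: nat and T :: "real set"
  assumes "m \<ge> 1"
    and "n = 2 * m \<and> T = {-1<..<1} \<or> n = 2 * m - 1 \<and> T = {-1<..<0} \<union> {0<..<1}"
  shows "AE t in (\<Pi>\<^sub>M k\<in>{0..n div 2}. (lborel :: real measure)).
           (\<forall>k\<in>{0..n div 2}. t k \<in> T) \<and> inj_on t {0..n div 2} \<longrightarrow>
           (\<forall>P\<in>bipoly_space n. \<forall>Q\<in>bipoly_space n.
              (\<forall>j\<in>{0..2 * m}. \<forall>k\<in>{0..n div 2}.
                 radon (radon_angle m j) P (t k) = radon (radon_angle m j) Q (t k)) \<longrightarrow>
              P = Q)"
proof -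
  let ?N = "Suc (n div 2)"
  have idx: "{0..n div 2} = {..<?N}" by auto
  have n: "n = 2 * m \<or> n = 2 * m - 1" and n2: "n \<le> 2 * m" using assms by auto
  let ?w = "\<lambda>p t. poly (case p of (a, b) \<Rightarrow> radon_poly a b) (complex_of_real t)"
  have "AE t in (\<Pi>\<^sub>M k\<in>{..<?N}. (lborel :: real measure)).
      \<forall>c. (\<forall>k<?N. (\<Sum>p\<in>freq_class m n r. c p * ?w p (t k)) = 0) \<longrightarrow> (\<forall>p\<in>freq_class m n r. c p = 0)" for r
  proof (rule AE_evaluation_injective)
    show "finite (freq_class m n r)"
      by (rule finite_subset[OF _ finite_deg_pairs[of n]]) (auto simp: freq_class_def)
    show "inj_on (\<lambda>p. degree (case p of (a, b) \<Rightarrow> radon_poly a b)) (freq_class m n r)"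
      using freq_class_degree_inj[OF n2, of r] by (simp add: case_prod_unfold degree_radon_poly)
  qed (use card_freq_class[OF assms(1) n] radon_poly_nonzero in auto)
  \<comment> \<open>Finitely many residue classes leave one null set, chosen before \<open>P\<close>
    and \<open>Q\<close>.\<close>
  then have "AE t in (\<Pi>\<^sub>M k\<in>{..<?N}. (lborel :: real measure)). \<forall>r\<in>{..<2 * m + 1}.
      \<forall>c. (\<forall>k<?N. (\<Sum>p\<in>freq_class m n r. c p * ?w p (t k)) = 0) \<longrightarrow> (\<forall>p\<in>freq_class m n r. c p = 0)"
    by (intro AE_finite_allI) auto
  then show ?thesis unfolding idx
  proof eventually_elim
    case (elim t)
    show ?case
    proof (intro impI ballI)
      fix P Q
      assume tT: "(\<forall>k\<in>{..<?N}. t k \<in> T) \<and> inj_on t {..<?N}"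
        and P: "P \<in> bipoly_space n" and Q: "Q \<in> bipoly_space n"
        and eq: "\<forall>j\<in>{0..2 * m}. \<forall>k\<in>{..<?N}. radon (radon_angle m j) P (t k) = radon (radon_angle m j) Q (t k)"
      obtain c d
        where c: "complex_of_real (P (Re z, Im z)) = (\<Sum>(a, b)\<in>deg_pairs n. c (a, b) * (z ^ a * cnj z ^ b))"
          and d: "complex_of_real (Q (Re z, Im z)) = (\<Sum>(a, b)\<in>deg_pairs n. d (a, b) * (z ^ a * cnj z ^ b))" for z
        using bipoly_space_conj_poly[OF P] bipoly_space_conj_poly[OF Q] unfolding conj_poly_def by blast
      have sum0: "(\<Sum>p\<in>freq_class m n r. (c p - d p) * ?w p (t k)) = 0" if "k < ?N" "r < 2 * m + 1" for k r
      proof -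
        have "t k \<in> T" using tT that by auto
        \<comment> \<open>Strictness makes the common factor, the half-chord length, nonzero and
          hence cancellable.\<close>
        then have "\<bar>t k\<bar> < 1" using assms(2) by auto
        then have t: "\<bar>t k\<bar> \<le> 1" "sqrt (1 - (t k)\<^sup>2) \<noteq> 0"
          by (simp_all add: power2_eq_1_iff abs_if split: if_splits)
        have "(\<Sum>p\<in>deg_pairs n. (c p - d p) * ?w p (t k) *
            cis (2 * pi * real j / real (2 * m + 1)) ^ (case p of (a, b) \<Rightarrow> a + 2 * m * b)) = 0"
          if "j < 2 * m + 1" for j
        proof -
          let ?th = "radon_angle m j"
          have "radon ?th P (t k) = radon ?th Q (t k)" using eq that \<open>k < ?N\<close> by auto
          then have "(\<Sum>(a, b)\<in>deg_pairs n. c (a, b) * (cis ?th ^ a * cnj (cis ?th) ^ b) * poly (radon_poly a b) (of_real (t k)))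
              = (\<Sum>(a, b)\<in>deg_pairs n. d (a, b) * (cis ?th ^ a * cnj (cis ?th) ^ b) * poly (radon_poly a b) (of_real (t k)))"
            using radon_conj_poly[OF c t(1), of ?th] radon_conj_poly[OF d t(1), of ?th] t(2) by simp
          then show ?thesis
            unfolding cis_radon_angle_frequency case_prod_beta
            by (simp add: algebra_simps sum_subtractf)
        qed
        from discrete_fourier_separation[OF finite_deg_pairs _ that(2) this]
        have "(\<Sum>p\<in>{p \<in> deg_pairs n. (case p of (a, b) \<Rightarrow> a + 2 * m * b) mod (2 * m + 1) = r}.
            (c p - d p) * ?w p (t k)) = 0" by simp
        moreover have "{p \<in> deg_pairs n. (case p of (a, b) \<Rightarrow> a + 2 * m * b) mod (2 * m + 1) = r} = freq_class m n r"
          by (auto simp: freq_class_def)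
        ultimately show ?thesis by simp
      qed
      have cd: "c (a, b) = d (a, b)" if "(a, b) \<in> deg_pairs n" for a b
      proof -
        let ?r = "(a + 2 * m * b) mod (2 * m + 1)"
        have "?r \<in> {..<2 * m + 1}" by simp
        moreover have "(a, b) \<in> freq_class m n ?r" using that by (simp add: freq_class_def)
        ultimately have "c (a, b) - d (a, b) = 0"
          using elim[rule_format, of ?r "\<lambda>p. c p - d p"] sum0 by blast
        then show ?thesis by simp
      qed
      have "P (x, y) = Q (x, y)" for x y
      proof -
        have "complex_of_real (P (x, y)) = of_real (Q (x, y))"
          using c[of "Complex x y"] d[of "Complex x y"] cd by (auto intro!: sum.cong)
        then show ?thesis by simp
      qed
      then show "P = Q" by auto
    qed
  qed
qed

end
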